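(* Let $s\in\mathbb{R}$, $1\le p<\infty$, and let $W:\mathbb{R}^n\to M_m(\mathbb{C})$ be a matrix weight in $\mathcal{A}_p$. (i) If $0<q_0\le q_1\le\infty$, then $M^{s}_{p,q_0}(W)\hookrightarrow M^{s}_{p,q_1}(W)$. (ii) If $0<q_0,q_1\le\infty$, $\epsilon>0$ and $\epsilon q_1>n$, then $M^{s+\epsilon}_{p,q_0}(W)\hookrightarrow M^{s}_{p,q_1}(W)$.
   Context: Fix $n,m\in\mathbb{N}$. $M_m(\mathbb{C})$ is the set of complex $m\times m$ matrices, $|\cdot|$ is the Euclidean norm on $\mathbb{C}^m$ and $\|\cdot\|$ the operator norm on $M_m(\mathbb{C})$. The symbol $\hookrightarrow$ denotes a continuous inclusion. A matrix weight is a function $W:\mathbb{R}^n\to M_m(\mathbb{C})$ such that $W(x)$ is nonnegative definite for every $x$, invertible for almost every $x$, and has locally integrable entries. For $1<p<\infty$, $W\in\mathcal{A}_p$ means $\sup_B\frac1{|B|}\int_B\big(\frac1{|B|}\int_B\|W^{1/p}(x)W^{-1/p}(y)\|^{p'}dy\big)^{p/p'}dx<\infty$, with $1/p+1/p'=1$; $W\in\mathcal{A}_1$ means $\sup_B\operatorname{ess\,sup}_{y\in B}\frac1{|B|}\int_B\|W(t)W^{-1}(y)\|dt<\infty$; suprema are over all balls $B\subset\mathbb{R}^n$. Let $Q_k=k+[-1/2,1/2)^n$ for $k\in\mathbb{Z}^n$. $Y$ is the set of sequences $\{\phi_k\}_{k\in\mathbb{Z}^n}$ of smooth functions such that, with constants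 $c>0$ and $C_\beta$ independent of $k$: $|\phi_k(\xi)|\ge c$ for $\xi\in Q_k$; $\operatorname{supp}\phi_k\subset\{\xi:|\xi-k|\le\sqrt n\}$; $\sum_k\phi_k(\xi)=1$ for all $\xi$; and $|D^\alpha\phi_k(\xi)|\le C_\beta$ for all $\xi\in\mathbb{R}^n$, $|\alpha|\le\beta$. Fix $\{\phi_k\}\in Y$ and let $\square_k=\mathcal{F}^{-1}\phi_k\mathcal{F}$, acting componentwise on $[\mathcal{S}'(\mathbb{R}^n)]^m$, the space of $m$-vectors of tempered distributions. Put $\langle k\rangle=(1+|k|^2)^{1/2}$ with $|k|=|k_1|+\dots+|k_n|$. For $0<q\le\infty$ and $s\in\mathbb{R}$, $M^s_{p,q}(W)$ is the set of $\vec f\in[\mathcal{S}'(\mathbb{R}^n)]^m$ with $\|\vec f\|_{M^s_{p,q}(W)}=\big(\sum_{k\in\mathbb{Z}^n}(\langle k\rangle^s\|W^{1/p}\square_k\vec f\|_{L^p})^q\big)^{1/q}<\infty$ (supremum over $k$ if $q=\infty$). *)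

theory Defs
  imports "HOL-Analysis.Analysis" "HOL-Probability.Essential_Supremum"
begin

definition adjoint_matrix :: "complex^'m^'m \<Rightarrow> complex^'m^'m" where
  "adjoint_matrix A = (\<chi> i j. cnj (A $ j $ i))"

definition unitary_matrix :: "complex^'m^'m \<Rightarrow> bool" where
  "unitary_matrix U \<longleftrightarrow> U ** adjoint_matrix U = mat 1 \<and> adjoint_matrix U ** U = mat 1"

definition diagonal_matrix :: "('m \<Rightarrow> real) \<Rightarrow> complex^'m^'m" where
  "diagonal_matrix d = (\<chi> i j. if i = j then complex_of_real (d i) else 0)"

definition nonneg_definite :: "complex^'m^'m \<Rightarrow> bool" where
  "nonneg_definite A \<longleftrightarrow> adjoint_matrix A = A \<and>
     (\<forall>v. 0 \<le> Re (\<Sum>i\<in>UNIV. (A *v v) $ i * cnj (v $ i)))"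

text \<open>The real power of a nonnegative definite matrix, by functional calculus: the eigenvalues
  are raised to the power \<open>t\<close> in a unitary diagonalisation.  The result does not depend on the
  diagonalisation.  Since \<open>0 powr t = 0\<close>, a negative power of a singular matrix is its
  generalised inverse power; matrix weights are singular only on a null set.\<close>

definition matrix_powr :: "complex^'m^'m \<Rightarrow> real \<Rightarrow> complex^'m^'m" where
  "matrix_powr A t = (THE B. \<exists>U d. unitary_matrix U \<and> (\<forall>i. 0 \<le> d i) \<and>
     A = U ** diagonal_matrix d ** adjoint_matrix U \<and>
     B = U ** diagonal_matrix (\<lambda>i. d i powr t) ** adjoint_matrix U)"

definition op_norm :: "complex^'m^'m \<Rightarrow> real" where
  "op_norm A = onorm (\<lambda>v. A *v v)"

definition matrix_weight :: "(real^'n \<Rightarrow> complex^'m^'m) \<Rightarrow> bool" where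
  "matrix_weight W \<longleftrightarrow>
     (\<forall>x. nonneg_definite (W x)) \<and>
     (AE x in lebesgue. invertible (W x)) \<and>
     (\<forall>K i j. compact K \<longrightarrow> set_integrable lebesgue K (\<lambda>x. W x $ i $ j))"

text \<open>Only used with exponents \<open>r > 0\<close>.\<close>

definition ennpowr :: "ennreal \<Rightarrow> real \<Rightarrow> ennreal" where
  "ennpowr a r = (if a = \<infinity> then \<infinity> else ennreal (enn2real a powr r))"

definition average :: "(real^'n) set \<Rightarrow> (real^'n \<Rightarrow> ennreal) \<Rightarrow> ennreal" where
  "average B f = (\<integral>\<^sup>+x\<in>B. f x \<partial>lebesgue) / emeasure lebesgue B"

definition A1_const :: "(real^'n \<Rightarrow> complex^'m^'m) \<Rightarrow> ennreal" where
  "A1_const W = (SUP B\<in>{ball x r | x r. 0 < r}.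
     esssup (restrict_space lebesgue B)
       (\<lambda>y. average B (\<lambda>t. ennreal (op_norm (W t ** matrix_inv (W y))))))"

definition Ap_const :: "real \<Rightarrow> (real^'n \<Rightarrow> complex^'m^'m) \<Rightarrow> ennreal" where
  "Ap_const p W = (let p' = p / (p - 1) in
     SUP B\<in>{ball x r | x r. 0 < r}.
       average B (\<lambda>x. ennpowr
         (average B (\<lambda>y. ennreal
            (op_norm (matrix_powr (W x) (1 / p) ** matrix_powr (W y) (- (1 / p))) powr p')))
         (p / p')))"

definition Ap_class :: "real \<Rightarrow> (real^'n \<Rightarrow> complex^'m^'m) set" where
  "Ap_class p = {W. matrix_weight W \<and> (if p = 1 then A1_const W else Ap_const p W) < \<infinity>}"

definition partial_deriv :: "'n \<Rightarrow> (real^'n \<Rightarrow> complex) \<Rightarrow> real^'n \<Rightarrow> complex" where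
  "partial_deriv i f = (\<lambda>x. frechet_derivative f (at x) (axis i 1))"

text \<open>A multi-index is represented by a list of coordinate directions, its order being the length
  of the list; for smooth functions the order of the differentiations is irrelevant, so that
  all \<open>D\<^sup>\<alpha>\<close>, and nothing else, arise in this way.\<close>

definition iter_deriv :: "'n list \<Rightarrow> (real^'n \<Rightarrow> complex) \<Rightarrow> real^'n \<Rightarrow> complex" where
  "iter_deriv \<alpha> f = foldr partial_deriv \<alpha> f"

definition smooth :: "(real^'n \<Rightarrow> complex) \<Rightarrow> bool" where
  "smooth f \<longleftrightarrow> (\<forall>\<alpha>. iter_deriv \<alpha> f differentiable_on UNIV)"

definition schwartz :: "(real^'n \<Rightarrow> complex) set" where
  "schwartz = {f. smooth f \<and> (\<forall>N \<alpha>. bounded (range (\<lambda>x. (1 + norm x) ^ N *\<^sub>R iter_deriv \<alpha> f x)))}"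

definition schwartz_seminorm :: "nat \<Rightarrow> 'n list \<Rightarrow> (real^'n \<Rightarrow> complex) \<Rightarrow> real" where
  "schwartz_seminorm N \<alpha> f = (SUP x. (1 + norm x) ^ N * norm (iter_deriv \<alpha> f x))"

definition schwartz_topology :: "(real^'n \<Rightarrow> complex) topology" where
  "schwartz_topology = topology_generated_by
     {{g \<in> schwartz. schwartz_seminorm N \<alpha> (\<lambda>x. g x - f x) < r} | N \<alpha> f r. f \<in> schwartz \<and> 0 < r}"

text \<open>Functionals on the Schwartz space are represented by total functions vanishing outside it,
  so that equal functionals are equal in HOL.\<close>

type_synonym 'n functional = "(real^'n \<Rightarrow> complex) \<Rightarrow> complex"

definition tempered :: "'n::finite functional \<Rightarrow> bool" where
  "tempered T \<longleftrightarrow>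
     (\<forall>\<psi>\<in>schwartz. \<forall>\<theta>\<in>schwartz. \<forall>a b. T (\<lambda>x. a * \<psi> x + b * \<theta> x) = a * T \<psi> + b * T \<theta>) \<and>
     continuous_map schwartz_topology euclidean T \<and>
     (\<forall>\<psi>. \<psi> \<notin> schwartz \<longrightarrow> T \<psi> = 0)"

text \<open>The unitary normalisation; the constants cancel in \<open>box\<close> below.\<close>

definition fourier :: "(real^'n \<Rightarrow> complex) \<Rightarrow> real^'n \<Rightarrow> complex" where
  "fourier \<psi> \<xi> = complex_of_real ((2 * pi) powr (- (real CARD('n) / 2))) *
     (\<integral>x. exp (- (\<i> * complex_of_real (x \<bullet> \<xi>))) * \<psi> x \<partial>lebesgue)"

definition inv_fourier :: "(real^'n \<Rightarrow> complex) \<Rightarrow> real^'n \<Rightarrow> complex" where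
  "inv_fourier \<psi> x = complex_of_real ((2 * pi) powr (- (real CARD('n) / 2))) *
     (\<integral>\<xi>. exp (\<i> * complex_of_real (x \<bullet> \<xi>)) * \<psi> \<xi> \<partial>lebesgue)"

definition fourier_distr :: "'n::finite functional \<Rightarrow> 'n functional" where
  "fourier_distr T = (\<lambda>\<psi>. if \<psi> \<in> schwartz then T (fourier \<psi>) else 0)"

definition inv_fourier_distr :: "'n::finite functional \<Rightarrow> 'n functional" where
  "inv_fourier_distr T = (\<lambda>\<psi>. if \<psi> \<in> schwartz then T (inv_fourier \<psi>) else 0)"

definition mult_distr :: "(real^'n \<Rightarrow> complex) \<Rightarrow> 'n::finite functional \<Rightarrow> 'n functional" where
  "mult_distr h T = (\<lambda>\<psi>. if \<psi> \<in> schwartz then T (\<lambda>x. h x * \<psi> x) else 0)"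

definition represents :: "(real^'n \<Rightarrow> complex) \<Rightarrow> 'n::finite functional \<Rightarrow> bool" where
  "represents g T \<longleftrightarrow> (\<forall>\<psi>\<in>schwartz. integrable lebesgue (\<lambda>x. g x * \<psi> x) \<and>
     T \<psi> = (\<integral>x. g x * \<psi> x \<partial>lebesgue))"

text \<open>The function with which a regular distribution is identified; it is unique almost
  everywhere.  It is only used for distributions with compactly supported Fourier transform,
  which are regular by the Paley--Wiener--Schwartz theorem.\<close>

definition function_of :: "'n::finite functional \<Rightarrow> real^'n \<Rightarrow> complex" where
  "function_of T = (SOME g. represents g T)"

definition int_vec :: "int^'n \<Rightarrow> real^'n" where
  "int_vec k = (\<chi> i. real_of_int (k $ i))"

definition cube :: "int^'n \<Rightarrow> (real^'n) set" where
  "cube k = {\<xi>. \<forall>i. int_vec k $ i - 1 / 2 \<le> \<xi> $ i \<and> \<xi> $ i < int_vec k $ i + 1 / 2}"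

definition decomposition_class :: "(int^'n \<Rightarrow> real^'n \<Rightarrow> complex) set" where
  "decomposition_class = {\<phi>.
     (\<forall>k. smooth (\<phi> k)) \<and>
     (\<exists>c>0. \<forall>k. \<forall>\<xi>\<in>cube k. c \<le> norm (\<phi> k \<xi>)) \<and>
     (\<forall>k. closure {\<xi>. \<phi> k \<xi> \<noteq> 0} \<subseteq> {\<xi>. norm (\<xi> - int_vec k) \<le> sqrt (real CARD('n))}) \<and>
     (\<forall>\<xi>. ((\<lambda>k. \<phi> k \<xi>) has_sum 1) UNIV) \<and>
     (\<forall>\<beta>. \<exists>C. \<forall>k \<xi> \<alpha>. length \<alpha> \<le> \<beta> \<longrightarrow> norm (iter_deriv \<alpha> (\<phi> k) \<xi>) \<le> C)}"

definition box ::
  "(int^'n \<Rightarrow> real^'n \<Rightarrow> complex) \<Rightarrow> int^'n \<Rightarrow> 'n::finite functional^'m \<Rightarrow> 'n functional^'m" where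
  "box \<phi> k f = (\<chi> i. inv_fourier_distr (mult_distr (\<phi> k) (fourier_distr (f $ i))))"

text \<open>Here \<open>|k|\<close> is the \<open>\<ell>\<^sup>1\<close> norm.\<close>

definition bracket :: "int^'n \<Rightarrow> real" where
  "bracket k = sqrt (1 + (\<Sum>i\<in>UNIV. \<bar>real_of_int (k $ i)\<bar>) ^ 2)"

definition weighted_Lp_norm ::
  "real \<Rightarrow> (real^'n \<Rightarrow> complex^'m^'m) \<Rightarrow> (real^'n \<Rightarrow> complex^'m) \<Rightarrow> ennreal" where
  "weighted_Lp_norm p W g =
     ennpowr (\<integral>\<^sup>+x. ennreal (norm (matrix_powr (W x) (1 / p) *v g x) powr p) \<partial>lebesgue) (1 / p)"

definition lq_norm :: "ennreal \<Rightarrow> ('k \<Rightarrow> ennreal) \<Rightarrow> ennreal" where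
  "lq_norm q a = (if q = \<infinity> then (SUP k. a k)
     else ennpowr (\<Sum>\<^sub>\<infinity>k. ennpowr (a k) (enn2real q)) (1 / enn2real q))"

definition modulation_norm ::
  "(int^'n \<Rightarrow> real^'n \<Rightarrow> complex) \<Rightarrow> (real^'n \<Rightarrow> complex^'m^'m) \<Rightarrow> real \<Rightarrow> real \<Rightarrow> ennreal \<Rightarrow>
    'n::finite functional^'m \<Rightarrow> ennreal" where
  "modulation_norm \<phi> W s p q f = lq_norm q (\<lambda>k. ennreal (bracket k powr s) *
     weighted_Lp_norm p W (\<lambda>x. \<chi> i. function_of (box \<phi> k f $ i) x))"

definition modulation_space ::
  "(int^'n \<Rightarrow> real^'n \<Rightarrow> complex) \<Rightarrow> (real^'n \<Rightarrow> complex^'m^'m) \<Rightarrow> real \<Rightarrow> real \<Rightarrow> ennreal \<Rightarrow>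
    ('n::finite functional^'m) set" where
  "modulation_space \<phi> W s p q =
     {f. (\<forall>i. tempered (f $ i)) \<and> modulation_norm \<phi> W s p q f < \<infinity>}"

text \<open>The topology on a set \<open>X\<close> given by a (quasi-)norm \<open>N\<close>: a set is open iff it contains a
  ball around each of its points.\<close>

definition quasinorm_topology :: "'a::minus set \<Rightarrow> ('a \<Rightarrow> ennreal) \<Rightarrow> 'a topology" where
  "quasinorm_topology X N = topology (\<lambda>U. U \<subseteq> X \<and>
     (\<forall>f\<in>U. \<exists>r>0. \<forall>g\<in>X. N (g - f) < r \<longrightarrow> g \<in> U))"

lemma openin_quasinorm_topology:
  "openin (quasinorm_topology X N) U \<longleftrightarrow>
     U \<subseteq> X \<and> (\<forall>f\<in>U. \<exists>r>0. \<forall>g\<in>X. N (g - f) < r \<longrightarrow> g \<in> U)"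
proof -
  have "istopology (\<lambda>U. U \<subseteq> X \<and> (\<forall>f\<in>U. \<exists>r>0. \<forall>g\<in>X. N (g - f) < r \<longrightarrow> g \<in> U))"
    unfolding istopology_def
  proof (rule conjI; intro allI impI conjI ballI)
    fix S T f
    assume S: "S \<subseteq> X \<and> (\<forall>f\<in>S. \<exists>r>0. \<forall>g\<in>X. N (g - f) < r \<longrightarrow> g \<in> S)"
      and T: "T \<subseteq> X \<and> (\<forall>f\<in>T. \<exists>r>0. \<forall>g\<in>X. N (g - f) < r \<longrightarrow> g \<in> T)"
      and f: "f \<in> S \<inter> T"
    obtain r where r: "r > 0" "\<forall>g\<in>X. N (g - f) < r \<longrightarrow> g \<in> S" using S f by blast
    obtain r' where r': "r' > 0" "\<forall>g\<in>X. N (g - f) < r' \<longrightarrow> g \<in> T" using T f by blast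
    show "\<exists>r>0. \<forall>g\<in>X. N (g - f) < r \<longrightarrow> g \<in> S \<inter> T"
      by (rule exI[of _ "min r r'"]) (use r r' in auto)
  next
    fix K f
    assume "\<forall>U\<in>K. U \<subseteq> X \<and> (\<forall>f\<in>U. \<exists>r>0. \<forall>g\<in>X. N (g - f) < r \<longrightarrow> g \<in> U)" "f \<in> \<Union> K"
    then show "\<exists>r>0. \<forall>g\<in>X. N (g - f) < r \<longrightarrow> g \<in> \<Union> K"
      by (meson UnionE UnionI)
  qed blast+
  then show ?thesis
    by (simp add: quasinorm_topology_def topology_inverse')
qed

lemma topspace_quasinorm_topology: "topspace (quasinorm_topology X N) = X"
proof
  show "topspace (quasinorm_topology X N) \<subseteq> X"
    unfolding topspace_def openin_quasinorm_topology by blast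
  have "openin (quasinorm_topology X N) X"
    unfolding openin_quasinorm_topology using zero_less_one by blast
  then show "X \<subseteq> topspace (quasinorm_topology X N)"
    by (rule openin_subset)
qed

definition modulation_topology ::
  "(int^'n \<Rightarrow> real^'n \<Rightarrow> complex) \<Rightarrow> (real^'n \<Rightarrow> complex^'m^'m) \<Rightarrow> real \<Rightarrow> real \<Rightarrow> ennreal \<Rightarrow>
    ('n::finite functional^'m) topology" where
  "modulation_topology \<phi> W s p q =
     quasinorm_topology (modulation_space \<phi> W s p q) (modulation_norm \<phi> W s p q)"

lemma topspace_modulation_topology:
  "topspace (modulation_topology \<phi> W s p q) = modulation_space \<phi> W s p q"
  by (simp add: modulation_topology_def topspace_quasinorm_topology)

definition continuous_inclusion :: "'a topology \<Rightarrow> 'a topology \<Rightarrow> bool"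
    (infix "\<hookrightarrow>" 50) where
  "S \<hookrightarrow> T \<longleftrightarrow> topspace S \<subseteq> topspace T \<and> continuous_map S T (\<lambda>f. f)"

end

theory Submission
  imports Defs
begin

text \<open>Both inclusions are inequalities between weighted \<open>\<ell>\<^sup>q\<close> norms of the sequence
  \<open>k \<mapsto> \<parallel>W\<^sup>1\<^sup>/\<^sup>p \<box>\<^sub>k f\<parallel>\<^sub>p\<close> in \<open>[0, \<infinity>]\<close>.  The first is the monotonicity of the \<open>\<ell>\<^sup>q\<close> norms.
  For the second, the target norm is at most the \<open>\<ell>\<^sup>q\<close> norm of \<open>\<langle>k\<rangle>\<^sup>-\<^sup>\<epsilon>\<close>, with \<open>q = q1\<close>,
  times the norm with parameters \<open>s + \<epsilon>\<close> and \<open>\<infinity>\<close>.  As \<open>\<langle>k\<rangle>\<close> dominates every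
  \<open>max 1 \<bar>k\<^sub>i\<bar>\<close>, the sum of \<open>\<langle>k\<rangle>\<^sup>-\<^sup>t\<close> with \<open>t > n\<close> is bounded by the \<open>n\<close>-th power of a
  convergent one-dimensional sum.\<close>

section \<open>Powers of extended nonnegative reals\<close>

lemma ennpowr_ennreal: "0 \<le> x \<Longrightarrow> ennpowr (ennreal x) r = ennreal (x powr r)"
  by (simp add: ennpowr_def)

lemma ennpowr_top [simp]: "ennpowr top r = top"
  by (simp add: ennpowr_def)

lemma ennpowr_mono:
  assumes "a \<le> b" "0 \<le> r"
  shows "ennpowr a r \<le> ennpowr b r"
proof (cases b)
  case b: (real y)
  then obtain x where "0 \<le> x" "a = ennreal x"
    using assms(1) by (cases a) (auto simp: top_unique)
  with b assms show ?thesis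
    by (auto simp: ennpowr_ennreal intro!: ennreal_leI powr_mono2)
qed simp

lemma ennpowr_ennpowr: "ennpowr (ennpowr a r) s = ennpowr a (r * s)"
  by (cases a) (auto simp: ennpowr_ennreal powr_powr)

lemma ennpowr_1 [simp]: "ennpowr a 1 = a"
  by (cases a) (auto simp: ennpowr_ennreal)

text \<open>Every real \<open>r\<close> is covered because the conventions agree:
  \<open>0 * \<infinity> = 0\<close>, \<open>0 powr r = 0\<close>, and \<open>ennpowr\<close> keeps
  \<open>\<infinity>\<close> fixed and sends nonzero values to nonzero values.\<close>

lemma ennpowr_mult: "ennpowr (a * b) r = ennpowr a r * ennpowr b r"
proof (cases "a = \<infinity> \<or> b = \<infinity>")
  case True
  have [simp]: "ennpowr 0 r = 0"
    by (simp add: ennpowr_def)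
  have *: "ennpowr c r \<noteq> 0" if "c \<noteq> 0" for c
    using that by (cases c) (auto simp: ennpowr_ennreal)
  show ?thesis
  proof (cases "a = 0 \<or> b = 0")
    case False
    with *[of a] *[of b] True show ?thesis
      by (elim disjE) simp_all
  qed auto
next
  case False
  then obtain x y where "0 \<le> x" "a = ennreal x" "0 \<le> y" "b = ennreal y"
    by (cases a; cases b) auto
  then show ?thesis
    by (simp add: ennpowr_ennreal powr_mult flip: ennreal_mult)
qed

section \<open>Power sums, finite and infinite\<close>

lemma sum_powr_le_powr_sum:
  fixes x :: "'k \<Rightarrow> real"
  assumes "finite F" "1 \<le> r" and nonneg: "\<And>k. k \<in> F \<Longrightarrow> 0 \<le> x k"
  shows "(\<Sum>k\<in>F. x k powr r) \<le> (\<Sum>k\<in>F. x k) powr r"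
proof -
  let ?S = "\<Sum>k\<in>F. x k"
  have "(\<Sum>k\<in>F. x k powr r) = (\<Sum>k\<in>F. x k * x k powr (r - 1))"
    using nonneg by (intro sum.cong) (auto simp: powr_mult_base)
  \<comment> \<open>Each term is at most the whole sum and \<open>r - 1\<close> is nonnegative.
    Bounding only this factor avoids dividing by \<open>?S\<close>, which may be zero.\<close>
  also have "\<dots> \<le> (\<Sum>k\<in>F. x k * ?S powr (r - 1))"
    using assms by (intro sum_mono mult_left_mono powr_mono2 member_le_sum) auto
  also have "\<dots> = ?S powr r"
    using nonneg by (simp add: powr_mult_base sum_nonneg flip: sum_distrib_right)
  finally show ?thesis .
qed

lemma sum_ennpowr_le_ennpowr_sum:
  assumes "finite F" "1 \<le> r"
  shows "(\<Sum>k\<in>F. ennpowr (a k) r) \<le> ennpowr (\<Sum>k\<in>F. a k) r"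
proof (cases "\<exists>k\<in>F. a k = \<infinity>")
  case True
  then have "(\<Sum>k\<in>F. a k) = top"
    using assms(1) by (auto simp: ennreal_sum_eq_top)
  then show ?thesis
    by simp
next
  case False
  define x where "x k = enn2real (a k)" for k
  have [simp]: "0 \<le> x k" for k
    by (simp add: x_def)
  have a: "a k = ennreal (x k)" if "k \<in> F" for k
    using False that by (simp add: x_def less_top)
  have "(\<Sum>k\<in>F. ennpowr (a k) r) = ennreal (\<Sum>k\<in>F. x k powr r)"
    by (simp add: a ennpowr_ennreal)
  also have "\<dots> \<le> ennreal ((\<Sum>k\<in>F. x k) powr r)"
    using assms by (intro ennreal_leI sum_powr_le_powr_sum) auto
  also have "\<dots> = ennpowr (\<Sum>k\<in>F. a k) r"
    by (simp add: a sum_nonneg flip: ennpowr_ennreal)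
  finally show ?thesis .
qed

text \<open>In \<open>ennreal\<close> every family is summable and its sum is the supremum of the
  finite partial sums. This bound and the next one reduce infinite sums to finite ones.\<close>

lemma infsum_ennreal_le:
  fixes f :: "'k \<Rightarrow> ennreal"
  assumes "\<And>F. finite F \<Longrightarrow> sum f F \<le> c"
  shows "infsum f UNIV \<le> c"
  by (rule infsum_le_finite_sums) (use assms in \<open>auto intro: nonneg_summable_on_complete\<close>)

lemma sum_le_infsum_ennreal:
  fixes f :: "'k \<Rightarrow> ennreal"
  assumes "finite F"
  shows "sum f F \<le> infsum f UNIV"
  using assms by (subst nonneg_infsum_complete) (auto intro: SUP_upper)

lemma infsum_ennpowr_le:
  assumes "1 \<le> r"
  shows "(\<Sum>\<^sub>\<infinity>k. ennpowr (a k) r) \<le> ennpowr (\<Sum>\<^sub>\<infinity>k. a k) r"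
proof (rule infsum_ennreal_le)
  fix F :: "'a set"
  assume "finite F"
  then show "(\<Sum>k\<in>F. ennpowr (a k) r) \<le> ennpowr (\<Sum>\<^sub>\<infinity>k. a k) r"
    using assms by (intro order_trans[OF sum_ennpowr_le_ennpowr_sum] ennpowr_mono sum_le_infsum_ennreal) auto
qed

section \<open>Inequalities between \<open>lq_norm\<close> values\<close>

lemma enn2real_pos:
  assumes "0 < q" "q \<noteq> \<infinity>"
  shows "0 < enn2real q"
  using assms by (simp add: enn2real_positive_iff less_top)

lemma SUP_le_lq_norm:
  assumes "0 < q"
  shows "(SUP k. a k) \<le> lq_norm q a"
proof (cases "q = \<infinity>")
  case False
  define r where "r = enn2real q"
  have r: "0 < r"
    using enn2real_pos assms False by (simp add: r_def)
  have "a k \<le> lq_norm q a" for k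
  proof -
    have "ennpowr (a k) r \<le> (\<Sum>\<^sub>\<infinity>k. ennpowr (a k) r)"
      using sum_le_infsum_ennreal[of "{k}" "\<lambda>k. ennpowr (a k) r"] by simp
    then have "ennpowr (ennpowr (a k) r) (1 / r) \<le> ennpowr (\<Sum>\<^sub>\<infinity>k. ennpowr (a k) r) (1 / r)"
      using r by (intro ennpowr_mono) auto
    then show ?thesis
      using r False by (simp add: ennpowr_ennpowr lq_norm_def r_def)
  qed
  then show ?thesis
    by (rule SUP_least)
qed (simp add: lq_norm_def)

lemma lq_norm_antimono:
  assumes "0 < q0" "q0 \<le> q1"
  shows "lq_norm q1 a \<le> lq_norm q0 a"
proof (cases "q1 = \<infinity>")
  case True
  then show ?thesis
    using SUP_le_lq_norm[OF assms(1), of a] by (simp add: lq_norm_def)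
next
  case False
  with assms have q0: "q0 \<noteq> \<infinity>"
    by (auto simp: top_unique)
  define r0 r1 where "r0 = enn2real q0" and "r1 = enn2real q1"
  have r: "0 < r0" "r0 \<le> r1"
    using assms False q0 enn2real_pos[of q0] enn2real_mono[of q0 q1]
    by (auto simp: r0_def r1_def less_top)
  \<comment> \<open>The ratio \<open>r1 / r0\<close> is at least 1, so the power sum inequality
    applies to the powers with exponent \<open>r0\<close>; afterwards
    \<open>(r1 / r0) * (1 / r1)\<close> collapses to \<open>1 / r0\<close>.\<close>
  have "(\<Sum>\<^sub>\<infinity>k. ennpowr (a k) r1) = (\<Sum>\<^sub>\<infinity>k. ennpowr (ennpowr (a k) r0) (r1 / r0))"
    using r by (simp add: ennpowr_ennpowr)
  also have "\<dots> \<le> ennpowr (\<Sum>\<^sub>\<infinity>k. ennpowr (a k) r0) (r1 / r0)"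
    using r by (intro infsum_ennpowr_le) simp
  finally have "ennpowr (\<Sum>\<^sub>\<infinity>k. ennpowr (a k) r1) (1 / r1)
      \<le> ennpowr (ennpowr (\<Sum>\<^sub>\<infinity>k. ennpowr (a k) r0) (r1 / r0)) (1 / r1)"
    using r by (intro ennpowr_mono) auto
  then show ?thesis
    using r False q0 by (simp add: ennpowr_ennpowr lq_norm_def r0_def r1_def)
qed

text \<open>This is the endpoint case of Hoelder's inequality: the supremum is a common factor that
  leaves the sum.\<close>

lemma lq_norm_mult_le:
  assumes "0 < q"
  shows "lq_norm q (\<lambda>k. w k * a k) \<le> lq_norm q w * (SUP k. a k)"
proof (cases "q = \<infinity>")
  case True
  then show ?thesis
    by (auto simp: lq_norm_def intro!: SUP_least mult_mono SUP_upper)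
next
  case False
  define r where "r = enn2real q"
  have r: "0 < r"
    using enn2real_pos assms False by (simp add: r_def)
  let ?c = "SUP k. a k"
  have "(\<Sum>\<^sub>\<infinity>k. ennpowr (w k * a k) r) \<le> (\<Sum>\<^sub>\<infinity>k. ennpowr (w k) r) * ennpowr ?c r"
  proof (rule infsum_ennreal_le)
    fix F :: "'a set"
    assume F: "finite F"
    have "(\<Sum>k\<in>F. ennpowr (w k * a k) r) \<le> (\<Sum>k\<in>F. ennpowr (w k) r * ennpowr ?c r)"
      using r by (intro sum_mono) (auto simp: ennpowr_mult intro!: mult_left_mono ennpowr_mono SUP_upper)
    also have "\<dots> \<le> (\<Sum>\<^sub>\<infinity>k. ennpowr (w k) r) * ennpowr ?c r"
      using F by (auto simp flip: sum_distrib_right intro!: mult_right_mono sum_le_infsum_ennreal)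
    finally show "(\<Sum>k\<in>F. ennpowr (w k * a k) r) \<le> \<dots>" .
  qed
  then have "ennpowr (\<Sum>\<^sub>\<infinity>k. ennpowr (w k * a k) r) (1 / r)
      \<le> ennpowr ((\<Sum>\<^sub>\<infinity>k. ennpowr (w k) r) * ennpowr ?c r) (1 / r)"
    using r by (intro ennpowr_mono) auto
  then show ?thesis
    using r False by (simp add: ennpowr_mult ennpowr_ennpowr lq_norm_def r_def)
qed

section \<open>Summability of negative powers of \<open>bracket\<close>\<close>

lemma bracket_ge_coordinate: "max 1 \<bar>real_of_int (k $ i)\<bar> \<le> bracket k"
proof -
  let ?S = "\<Sum>i\<in>UNIV. \<bar>real_of_int (k $ i)\<bar>"
  have "\<bar>real_of_int (k $ i)\<bar> \<le> ?S"
    by (rule member_le_sum) auto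
  also have "\<dots> \<le> bracket k"
    unfolding bracket_def by (rule real_le_rsqrt) simp
  finally show ?thesis
    by (simp add: bracket_def)
qed

lemma bracket_ge_1: "1 \<le> bracket k"
  by (simp add: bracket_def)

text \<open>The decay is shared equally among the coordinates, and a nonpositive exponent reverses
  the bound by each coordinate. The maximum with 1 keeps the bases positive, since
  \<open>0 powr\<close> any exponent is 0 in HOL.\<close>

lemma bracket_powr_le_prod:
  fixes k :: "int^'n"
  assumes "0 \<le> t"
  shows "bracket k powr (- t)
    \<le> (\<Prod>i\<in>UNIV. max 1 \<bar>real_of_int (k $ i)\<bar> powr (- (t / real CARD('n))))"
proof -
  have "bracket k powr (- t) = (\<Prod>i\<in>(UNIV :: 'n set). bracket k powr (- (t / real CARD('n))))"
    using bracket_ge_1[of k] by (auto simp: powr_power)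
  also have "\<dots> \<le> (\<Prod>i\<in>UNIV. max 1 \<bar>real_of_int (k $ i)\<bar> powr (- (t / real CARD('n))))"
    using assms by (intro prod_mono conjI powr_mono2' bracket_ge_coordinate) auto
  finally show ?thesis .
qed

lemma sum_int_powr_bounded:
  assumes "1 < a"
  obtains C where "\<And>F. finite F \<Longrightarrow> (\<Sum>j\<in>F. max 1 \<bar>real_of_int j\<bar> powr (- a)) \<le> C"
proof
  fix F :: "int set"
  assume F: "finite F"
  let ?f = "\<lambda>j. max 1 \<bar>real_of_int j\<bar> powr (- a)"
  let ?g = "\<lambda>n. real n powr (- a)"
  have summable: "summable ?g"
    using assms by (subst summable_real_powr_iff) simp
  \<comment> \<open>At \<open>n = 0\<close> the left side is 2 while \<open>?g 0\<close> is 0 by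
    convention; the indicator term makes up for this and contributes the summand 2 of the final
    bound.\<close>
  have g: "?f (- int n) + ?f (int n) \<le> 2 * (if n = 0 then 1 else 0) + 2 * ?g n" for n
    by (cases "n = 0") (auto simp: max_def)
  have "finite ((\<lambda>j. nat \<bar>j\<bar>) ` F)"
    using F by simp
  then obtain N where N: "\<And>j. j \<in> F \<Longrightarrow> nat \<bar>j\<bar> < N"
    by (metis finite_nat_set_iff_bounded imageI)
  have "sum ?f F \<le> sum ?f ((\<lambda>n. - int n) ` {..<N} \<union> int ` {..<N})"
  proof (intro sum_mono2)
    show "F \<subseteq> (\<lambda>n. - int n) ` {..<N} \<union> int ` {..<N}"
    proof
      fix j
      assume "j \<in> F"
      then have "nat \<bar>j\<bar> \<in> {..<N}" "j = int (nat \<bar>j\<bar>) \<or> j = - int (nat \<bar>j\<bar>)"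
        using N by auto
      then show "j \<in> (\<lambda>n. - int n) ` {..<N} \<union> int ` {..<N}"
        by blast
    qed
  qed auto
  \<comment> \<open>Only an inequality, because 0 may lie in both images and is then counted
    twice.\<close>
  also have "\<dots> \<le> sum ?f ((\<lambda>n. - int n) ` {..<N}) + sum ?f (int ` {..<N})"
    by (subst sum.union_inter[symmetric]) (auto intro!: sum_nonneg)
  also have "\<dots> = (\<Sum>n<N. ?f (- int n) + ?f (int n))"
    by (simp add: sum.reindex inj_on_def sum.distrib sum_distrib_left)
  also have "\<dots> \<le> (\<Sum>n<N. 2 * (if n = 0 then 1 else 0) + 2 * ?g n)"
    by (intro sum_mono g)
  also have "\<dots> = (\<Sum>n<N. 2 * (if n = 0 then 1 else 0)) + 2 * (\<Sum>n<N. ?g n)"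
    by (simp add: sum.distrib sum_distrib_left)
  also have "\<dots> \<le> 2 + 2 * suminf ?g"
  proof -
    have "(\<Sum>n<N. ?g n) \<le> suminf ?g"
      by (rule sum_le_suminf[OF summable]) auto
    moreover have "(\<Sum>n<N. 2 * (if n = 0 then 1 else 0)) \<le> (2 :: real)"
      by (simp add: sum.delta flip: sum_distrib_left)
    ultimately show ?thesis
      by linarith
  qed
  finally show "sum ?f F \<le> 2 + 2 * suminf ?g" .
qed

lemma sum_bracket_powr_bounded:
  assumes "real CARD('n) < t"
  obtains C where "\<And>F :: (int^'n) set. finite F \<Longrightarrow> (\<Sum>k\<in>F. bracket k powr (- t)) \<le> C"
proof -
  define a where "a = t / real CARD('n)"
  have "1 < a"
    using assms by (simp add: a_def)
  then obtain C where C: "\<And>F. finite F \<Longrightarrow> (\<Sum>j\<in>F. max 1 \<bar>real_of_int j\<bar> powr (- a)) \<le> C"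
    by (rule sum_int_powr_bounded) blast
  have "(\<Sum>k\<in>F. bracket k powr (- t)) \<le> C ^ CARD('n)" if F: "finite F" for F :: "(int^'n) set"
  proof -
    \<comment> \<open>\<open>G\<close> collects all coordinates of members of \<open>F\<close>, so
      \<open>F\<close> lies in a finite box with side \<open>G\<close>. Over that box the sum of
      products factors into one-dimensional sums, each with exponent \<open>a > 1\<close>.\<close>
    define G where "G = (\<lambda>(k, i). k $ i) ` (F \<times> (UNIV :: 'n set))"
    have G: "finite G"
      using F by (simp add: G_def)
    let ?f = "\<lambda>j. max 1 \<bar>real_of_int j\<bar> powr (- a)"
    have "(\<Sum>k\<in>F. bracket k powr (- t)) \<le> (\<Sum>k\<in>F. \<Prod>i\<in>UNIV. ?f (k $ i))"
      using assms unfolding a_def by (intro sum_mono bracket_powr_le_prod) linarith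
    also have "\<dots> = (\<Sum>x\<in>vec_nth ` F. \<Prod>i\<in>UNIV. ?f (x i))"
      by (subst sum.reindex) (auto simp: inj_on_def vec_nth_inject)
    also have "\<dots> \<le> (\<Sum>x\<in>PiE (UNIV :: 'n set) (\<lambda>_. G). \<Prod>i\<in>UNIV. ?f (x i))"
    proof (rule sum_mono2)
      show "finite (UNIV \<rightarrow>\<^sub>E G :: ('n \<Rightarrow> int) set)"
        using G by (intro finite_PiE) auto
      show "vec_nth ` F \<subseteq> UNIV \<rightarrow>\<^sub>E G"
        by (force simp: G_def PiE_iff)
    qed (simp add: prod_nonneg)
    also have "\<dots> = (\<Prod>i\<in>(UNIV :: 'n set). \<Sum>j\<in>G. ?f j)"
      by (rule prod_sum_PiE[symmetric]) (use G in auto)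
    also have "\<dots> \<le> C ^ CARD('n)"
      using C[OF G] by (auto intro!: power_mono sum_nonneg)
    finally show ?thesis .
  qed
  then show thesis
    by (rule that)
qed

text \<open>For infinite \<open>q\<close> the supremum is at most 1, as brackets are at least 1. For
  finite \<open>q\<close> the terms are powers of brackets with exponent
  \<open>- (\<epsilon> * r)\<close>, and \<open>\<epsilon> * r\<close> exceeds the
  dimension.\<close>

lemma lq_norm_bracket_finite:
  assumes "0 < q" "0 < \<epsilon>" "ennreal \<epsilon> * q > of_nat CARD('n)"
  shows "lq_norm q (\<lambda>k :: int^'n. ennreal (bracket k powr (- \<epsilon>))) < \<infinity>"
proof (cases "q = \<infinity>")
  case True
  have "(SUP k :: int^'n. ennreal (bracket k powr (- \<epsilon>))) \<le> ennreal 1"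
    using assms(2) bracket_ge_1 powr_mono2'[of "- \<epsilon>" 1]
    by (intro SUP_least ennreal_leI) auto
  with True show ?thesis
    by (simp add: lq_norm_def order_le_less_trans)
next
  case False
  define r where "r = enn2real q"
  have q: "q = ennreal r"
    using False by (simp add: r_def less_top)
  have "ennreal (real CARD('n)) < ennreal (\<epsilon> * r)"
    using assms(2,3) by (simp add: q ennreal_mult' ennreal_of_nat_eq_real_of_nat)
  then have "real CARD('n) < \<epsilon> * r"
    by (simp add: ennreal_less_iff)
  then obtain C where C: "\<And>F :: (int^'n) set. finite F \<Longrightarrow> (\<Sum>k\<in>F. bracket k powr (- (\<epsilon> * r))) \<le> C"
    by (rule sum_bracket_powr_bounded) blast
  have "(\<Sum>\<^sub>\<infinity>k :: int^'n. ennpowr (ennreal (bracket k powr (- \<epsilon>))) r) \<le> ennreal C"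
  proof (rule infsum_ennreal_le)
    fix F :: "(int^'n) set"
    assume "finite F"
    then show "(\<Sum>k\<in>F. ennpowr (ennreal (bracket k powr (- \<epsilon>))) r) \<le> ennreal C"
      using C by (simp add: ennpowr_ennreal powr_powr ennreal_leI)
  qed
  then have "(\<Sum>\<^sub>\<infinity>k :: int^'n. ennpowr (ennreal (bracket k powr (- \<epsilon>))) r) < \<infinity>"
    by (simp add: order_le_less_trans)
  then show ?thesis
    using False by (simp add: lq_norm_def ennpowr_def r_def)
qed

section \<open>From norm inequalities to continuous inclusions\<close>

lemma quasinorm_topology_inclusion:
  assumes bound: "\<And>f. N' f \<le> C * N f" and C: "C < \<infinity>" and sub: "X \<subseteq> Y"
  shows "quasinorm_topology X N \<hookrightarrow> quasinorm_topology Y N'"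
  unfolding continuous_inclusion_def topspace_quasinorm_topology
proof (intro conjI sub)
  have "openin (quasinorm_topology X N) {f \<in> X. f \<in> U}" if U: "openin (quasinorm_topology Y N') U" for U
    unfolding openin_quasinorm_topology
  proof (intro conjI ballI)
    fix f
    assume "f \<in> {f \<in> X. f \<in> U}"
    then have "f \<in> U"
      by simp
    with U obtain r where r: "r > 0" "\<And>g. g \<in> Y \<Longrightarrow> N' (g - f) < r \<Longrightarrow> g \<in> U"
      unfolding openin_quasinorm_topology by metis
    \<comment> \<open>The ball of radius \<open>r / D\<close> for \<open>N\<close> will lie in the
      ball of radius \<open>r\<close> for \<open>N'\<close> about the same centre. Adding 1 keeps
      \<open>D\<close> positive when \<open>C = 0\<close>, so that multiplication by
      \<open>D\<close> is strictly monotone and cancels the division.\<close>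
    define D where "D = C + 1"
    have D: "0 < D" "D < top" "C \<le> D"
      using C by (auto simp: D_def zero_less_iff_neq_zero)
    have "g \<in> U" if g: "g \<in> X" "N (g - f) < r / D" for g
    proof -
      have "N' (g - f) \<le> D * N (g - f)"
        using bound D(3) by (rule order_trans[OF _ mult_right_mono]) simp
      also have "\<dots> < D * (r / D)"
        using g(2) D by (intro ennreal_mult_strict_left_mono) auto
      also have "\<dots> = r"
        using D by (metis ennreal_mult_divide_eq ennreal_times_divide less_irrefl mult.commute)
      finally show ?thesis
        using r(2) g(1) sub by blast
    qed
    moreover have "0 < r / D"
      using r(1) D by (simp add: ennreal_zero_less_divide)
    ultimately show "\<exists>r'>0. \<forall>g\<in>X. N (g - f) < r' \<longrightarrow> g \<in> {f \<in> X. f \<in> U}"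
      by blast
  qed auto
  then show "continuous_map (quasinorm_topology X N) (quasinorm_topology Y N') (\<lambda>f. f)"
    using sub by (auto simp: continuous_map_def topspace_quasinorm_topology)
qed

text \<open>The bound ranges over all \<open>f\<close>, so it applies to the differences in the
  definition of the topology without any check that they belong to the space.\<close>

lemma modulation_inclusion:
  assumes bound: "\<And>f. modulation_norm \<phi> W s' p q' f \<le> C * modulation_norm \<phi> W s p q f"
    and C: "C < \<infinity>"
  shows "modulation_topology \<phi> W s p q \<hookrightarrow> modulation_topology \<phi> W s' p q'"
proof -
  have "modulation_norm \<phi> W s' p q' f < \<infinity>" if "modulation_norm \<phi> W s p q f < \<infinity>" for f
    using bound[of f] C that by (simp add: ennreal_mult_less_top order_le_less_trans)
  then have "modulation_space \<phi> W s p q \<subseteq> modulation_space \<phi> W s' p q'"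
    by (auto simp: modulation_space_def)
  then show ?thesis
    unfolding modulation_topology_def by (rule quasinorm_topology_inclusion[OF bound C])
qed

section \<open>The two modulation norm inequalities and the inclusions\<close>

lemma modulation_norm_antimono:
  assumes "0 < q0" "q0 \<le> q1"
  shows "modulation_norm \<phi> W s p q1 f \<le> modulation_norm \<phi> W s p q0 f"
  unfolding modulation_norm_def by (rule lq_norm_antimono[OF assms])

text \<open>The weight splits off a factor with exponent \<open>- \<epsilon>\<close>, whose norm
  becomes the constant. Passing through the supremum of the remaining terms allows \<open>q0\<close>
  and \<open>q1\<close> in either order.\<close>

lemma modulation_norm_le:
  fixes \<phi> :: "int^'n \<Rightarrow> real^'n \<Rightarrow> complex"
  assumes "0 < q0" "0 < q1"
  shows "modulation_norm \<phi> W s p q1 f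
    \<le> lq_norm q1 (\<lambda>k :: int^'n. ennreal (bracket k powr (- \<epsilon>))) * modulation_norm \<phi> W (s + \<epsilon>) p q0 f"
proof -
  define b where "b k = weighted_Lp_norm p W (\<lambda>x. \<chi> i. function_of (box \<phi> k f $ i) x)" for k
  let ?w = "\<lambda>k :: int^'n. ennreal (bracket k powr (- \<epsilon>))"
  let ?a = "\<lambda>k. ennreal (bracket k powr (s + \<epsilon>)) * b k"
  have "bracket k powr s = bracket k powr (- \<epsilon>) * bracket k powr (s + \<epsilon>)" for k :: "int^'n"
    by (simp flip: powr_add)
  then have "ennreal (bracket k powr s) * b k = ?w k * ?a k" for k
    by (metis ennreal_mult mult.assoc powr_ge_zero)
  then have "modulation_norm \<phi> W s p q1 f = lq_norm q1 (\<lambda>k. ?w k * ?a k)"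
    by (simp add: modulation_norm_def b_def)
  also have "\<dots> \<le> lq_norm q1 ?w * (SUP k. ?a k)"
    by (rule lq_norm_mult_le[OF assms(2)])
  also have "\<dots> \<le> lq_norm q1 ?w * lq_norm q0 ?a"
    by (intro mult_left_mono SUP_le_lq_norm assms(1)) simp
  finally show ?thesis
    by (simp add: modulation_norm_def b_def)
qed

theorem theorem5p1:
  fixes \<phi> :: "int^'n \<Rightarrow> real^'n \<Rightarrow> complex"
    and W :: "real^'n \<Rightarrow> complex^'m^'m"
    and s p :: real
  assumes "\<phi> \<in> decomposition_class"
    and "1 \<le> p"
    and "matrix_weight W"
    and "W \<in> Ap_class p"
  shows "(\<forall>q0 q1 :: ennreal. 0 < q0 \<and> q0 \<le> q1 \<longrightarrow>
            modulation_topology \<phi> W s p q0 \<hookrightarrow> modulation_topology \<phi> W s p q1)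
       \<and> (\<forall>(q0 :: ennreal) (q1 :: ennreal) (\<epsilon> :: real).
            0 < q0 \<and> 0 < q1 \<and> 0 < \<epsilon> \<and> ennreal \<epsilon> * q1 > of_nat CARD('n) \<longrightarrow>
            modulation_topology \<phi> W (s + \<epsilon>) p q0 \<hookrightarrow> modulation_topology \<phi> W s p q1)"
proof (intro conjI allI impI; elim conjE)
  fix q0 q1 :: ennreal
  assume "0 < q0" "q0 \<le> q1"
  then show "modulation_topology \<phi> W s p q0 \<hookrightarrow> modulation_topology \<phi> W s p q1"
    by (intro modulation_inclusion[where C = 1]) (simp_all add: modulation_norm_antimono)
next
  fix q0 q1 :: ennreal and \<epsilon> :: real
  assume "0 < q0" "0 < q1" "0 < \<epsilon>" "ennreal \<epsilon> * q1 > of_nat CARD('n)"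
  then show "modulation_topology \<phi> W (s + \<epsilon>) p q0 \<hookrightarrow> modulation_topology \<phi> W s p q1"
    by (intro modulation_inclusion[OF modulation_norm_le lq_norm_bracket_finite])
qed

end
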